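(* Let $\lambda=\lambda_1\varepsilon_1+\dots+\lambda_n\varepsilon_n$ with integers $\lambda_i\ge0$ and $\lambda_1+\dots+\lambda_n=n$, and let $\alpha\in\mathbb C$. Then the matrix $$\widetilde F_q^\lambda(\alpha)=\bigl(\widetilde F_{n,q}(\alpha;\boldsymbol i;\boldsymbol j)\bigr)_{\boldsymbol i,\boldsymbol j\in I_n(\lambda)}$$ is symmetric.
   Context: $n\ge1$ is an integer; $q$ is a nonzero complex number that is not a root of unity; $\alpha^0=1$. $S_n$ is the symmetric group; for $w\in S_n$, $\ell(w)$ is the number of inversions and $\nu_n(w)$ the number of cycles (fixed points included). $A_q(\mathrm{Mat}_n)$ is the associative $\mathbb C$-algebra generated by $x_{ij}$ ($1\le i,j\le n$) with relations $x_{ik}x_{jk}=qx_{jk}x_{ik}$, $x_{ki}x_{kj}=qx_{kj}x_{ki}$ ($i<j$); $x_{il}x_{jk}=x_{jk}x_{il}$, $x_{ik}x_{jl}-x_{jl}x_{ik}=(q-q^{-1})x_{il}x_{jk}$ ($i<j$, $k<l$). For $\boldsymbol j=(j_1,\dots,j_n)\in\{1,\dots,n\}^n$ put $D_q^{(\alpha)}(\boldsymbol j)=\sum_{w\in S_n}\alpha^{n-\nu_n(w)}q^{\ell(w)}x_{w(1)j_1}\cdots x_{w(n)j_n}$. The monomials $D_q^{(0)}(\boldsymbol i)=x_{1i_1}\cdots x_{ni_n}$ are linearly independent, each $D_q^{(\alpha)}(\boldsymbol j)$ lies in their span, and the coefficients $\widetilde F_{n,q}(\alpha;\boldsymbol i;\boldsymbol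 j)$ are defined by $$D_q^{(\alpha)}(\boldsymbol j)=\sum_{\boldsymbol i\in\{1,\dots,n\}^n}\widetilde F_{n,q}(\alpha;\boldsymbol i;\boldsymbol j)\,D_q^{(0)}(\boldsymbol i).$$ $I_n(\lambda)$ is the set of $\boldsymbol i\in\{1,\dots,n\}^n$ in which each value $p$ occurs exactly $\lambda_p$ times. It is also assumed that $q$ is generic in the sense that it maximizes, as a function of $q$, the cardinality of the finite set of $\alpha\in\mathbb C$ for which the $n^n$ elements $D_q^{(\alpha)}(\boldsymbol j)$ are linearly dependent. *)

theory Defs
  imports Complex_Main
    "HOL-Library.Poly_Mapping"
    "HOL-Library.FuncSet"
    "HOL-Combinatorics.Permutations"
    "HOL-Combinatorics.Orbits"
    "HOL-Algebra.QuotRing"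
begin

section \<open>Free associative algebras\<close>

text \<open>Words form a monoid under concatenation, written additively because
  \<open>poly_mapping\<close> multiplies by adding exponents. Thus
  \<open>'a nc_word \<Rightarrow>\<^sub>0 complex\<close> with its class multiplication is
  the free associative algebra on \<open>'a\<close>.\<close>

datatype 'a nc_word = Word (letters: "'a list")

instantiation nc_word :: (type) monoid_add
begin

definition zero_nc_word_def: "0 = Word []"

definition plus_nc_word_def: "u + v = Word (letters u @ letters v)"

instance
  by standard (simp_all add: zero_nc_word_def plus_nc_word_def)

end

type_synonym nc_poly = "(nat \<times> nat) nc_word \<Rightarrow>\<^sub>0 complex"

definition nc_const :: "complex \<Rightarrow> nc_poly" where
  "nc_const c = Poly_Mapping.single 0 c"

definition nc_var :: "nat \<Rightarrow> nat \<Rightarrow> nc_poly" where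
  "nc_var i j = Poly_Mapping.single (Word [(i, j)]) 1"

definition free_alg :: "nat \<Rightarrow> nc_poly ring" where
  "free_alg n =
     \<lparr>carrier = {f. \<forall>u \<in> Poly_Mapping.keys f. set (letters u) \<subseteq> {1..n} \<times> {1..n}},
      mult = (*), one = 1, zero = 0, add = (+)\<rparr>"

lemma ring_free_alg: "ring (free_alg n)"
proof -
  have uminus: "- f \<in> carrier (free_alg n)" if "f \<in> carrier (free_alg n)" for f
    using that by (auto simp: free_alg_def in_keys_iff)
  have plus: "f + g \<in> carrier (free_alg n)"
    if "f \<in> carrier (free_alg n)" "g \<in> carrier (free_alg n)" for f g
    using that Poly_Mapping.keys_add[of f g] by (auto simp: free_alg_def)
  have times: "f * g \<in> carrier (free_alg n)"
    if "f \<in> carrier (free_alg n)" "g \<in> carrier (free_alg n)" for f g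
    using that keys_mult[of f g] by (fastforce simp: free_alg_def plus_nc_word_def)
  have zero: "0 \<in> carrier (free_alg n)" and one: "1 \<in> carrier (free_alg n)"
    by (auto simp: free_alg_def zero_nc_word_def)
  have sel: "add (free_alg n) = (+)" "mult (free_alg n) = (*)"
    "ring.zero (free_alg n) = 0" "one (free_alg n) = 1"
    by (simp_all add: free_alg_def)
  show ?thesis
  proof (rule ringI)
    show "abelian_group (free_alg n)"
    proof (rule abelian_groupI)
      fix f assume f: "f \<in> carrier (free_alg n)"
      show "\<exists>g \<in> carrier (free_alg n). g \<oplus>\<^bsub>free_alg n\<^esub> f = \<zero>\<^bsub>free_alg n\<^esub>"
        by (rule bexI[OF _ uminus[OF f]]) (simp add: sel)
    qed (simp_all add: sel plus zero ac_simps)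
    show "monoid (free_alg n)"
      by (rule monoidI) (simp_all add: sel times one mult.assoc)
  qed (simp_all add: sel distrib_left distrib_right)
qed

section \<open>The quantum matrix algebra\<close>

definition qmat_relations :: "nat \<Rightarrow> complex \<Rightarrow> nc_poly set" where
  "qmat_relations n q =
     {nc_var i k * nc_var j k - nc_const q * (nc_var j k * nc_var i k) | i j k.
        i \<in> {1..n} \<and> j \<in> {1..n} \<and> k \<in> {1..n} \<and> i < j}
   \<union> {nc_var k i * nc_var k j - nc_const q * (nc_var k j * nc_var k i) | i j k.
        i \<in> {1..n} \<and> j \<in> {1..n} \<and> k \<in> {1..n} \<and> i < j}
   \<union> {nc_var i l * nc_var j k - nc_var j k * nc_var i l | i j k l.
        i \<in> {1..n} \<and> j \<in> {1..n} \<and> k \<in> {1..n} \<and> l \<in> {1..n} \<and> i < j \<and> k < l}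
   \<union> {nc_var i k * nc_var j l - nc_var j l * nc_var i k
          - nc_const (q - inverse q) * (nc_var i l * nc_var j k) | i j k l.
        i \<in> {1..n} \<and> j \<in> {1..n} \<and> k \<in> {1..n} \<and> l \<in> {1..n} \<and> i < j \<and> k < l}"

definition qmat_ideal :: "nat \<Rightarrow> complex \<Rightarrow> nc_poly set" where
  "qmat_ideal n q = Idl\<^bsub>free_alg n\<^esub> (qmat_relations n q)"

definition qmat_alg :: "nat \<Rightarrow> complex \<Rightarrow> nc_poly set ring" where
  "qmat_alg n q = free_alg n Quot qmat_ideal n q"

definition qmat_class :: "nat \<Rightarrow> complex \<Rightarrow> nc_poly \<Rightarrow> nc_poly set" where
  "qmat_class n q f = qmat_ideal n q +>\<^bsub>free_alg n\<^esub> f"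

definition qmat_gen :: "nat \<Rightarrow> complex \<Rightarrow> nat \<Rightarrow> nat \<Rightarrow> nc_poly set" where
  "qmat_gen n q i j = qmat_class n q (nc_var i j)"

definition qmat_smult :: "nat \<Rightarrow> complex \<Rightarrow> complex \<Rightarrow> nc_poly set \<Rightarrow> nc_poly set" where
  "qmat_smult n q c a = qmat_class n q (nc_const c) \<otimes>\<^bsub>qmat_alg n q\<^esub> a"

section \<open>Quantum alpha-determinants\<close>

definition perm_length :: "nat \<Rightarrow> (nat \<Rightarrow> nat) \<Rightarrow> nat" where
  "perm_length n w = card {(a, b). a \<in> {1..n} \<and> b \<in> {1..n} \<and> a < b \<and> w b < w a}"

definition cycle_count :: "nat \<Rightarrow> (nat \<Rightarrow> nat) \<Rightarrow> nat" where
  "cycle_count n w = card (orbit w ` {1..n})"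

definition multi_indices :: "nat \<Rightarrow> (nat \<Rightarrow> nat) set" where
  "multi_indices n = {1..n} \<rightarrow>\<^sub>E {1..n}"

text \<open>The product is taken in the order \<open>k = 1, ..., n\<close>.\<close>

definition qmat_monomial ::
    "nat \<Rightarrow> complex \<Rightarrow> (nat \<Rightarrow> nat) \<Rightarrow> (nat \<Rightarrow> nat) \<Rightarrow> nc_poly set" where
  "qmat_monomial n q w j =
     foldr (\<lambda>k a. qmat_gen n q (w k) (j k) \<otimes>\<^bsub>qmat_alg n q\<^esub> a) [1..<Suc n] \<one>\<^bsub>qmat_alg n q\<^esub>"

definition alpha_qdet :: "nat \<Rightarrow> complex \<Rightarrow> complex \<Rightarrow> (nat \<Rightarrow> nat) \<Rightarrow> nc_poly set" where
  "alpha_qdet n q \<alpha> j =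
     (\<Oplus>\<^bsub>qmat_alg n q\<^esub> w \<in> {w. w permutes {1..n}}.
        qmat_smult n q (\<alpha> ^ (n - cycle_count n w) * q ^ perm_length n w)
          (qmat_monomial n q w j))"

definition F_coeff ::
    "nat \<Rightarrow> complex \<Rightarrow> complex \<Rightarrow> (nat \<Rightarrow> nat) \<Rightarrow> (nat \<Rightarrow> nat) \<Rightarrow> complex" where
  "F_coeff n q \<alpha> i j =
     (THE c. c \<in> multi_indices n \<rightarrow>\<^sub>E UNIV \<and>
        alpha_qdet n q \<alpha> j =
          (\<Oplus>\<^bsub>qmat_alg n q\<^esub> k \<in> multi_indices n.
             qmat_smult n q (c k) (alpha_qdet n q 0 k))) i"

definition weight_indices :: "nat \<Rightarrow> (nat \<Rightarrow> nat) \<Rightarrow> (nat \<Rightarrow> nat) set" where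
  "weight_indices n lam =
     {i \<in> multi_indices n. \<forall>p \<in> {1..n}. card {k \<in> {1..n}. i k = p} = lam p}"

section \<open>Genericity of the parameter\<close>

definition nonzero_non_root_of_unity :: "complex \<Rightarrow> bool" where
  "nonzero_non_root_of_unity q \<longleftrightarrow> q \<noteq> 0 \<and> (\<forall>m::nat. 0 < m \<longrightarrow> q ^ m \<noteq> 1)"

definition singular_alphas :: "nat \<Rightarrow> complex \<Rightarrow> complex set" where
  "singular_alphas n q =
     {\<alpha>. \<exists>c. (\<exists>j \<in> multi_indices n. c j \<noteq> 0) \<and>
        (\<Oplus>\<^bsub>qmat_alg n q\<^esub> j \<in> multi_indices n.
           qmat_smult n q (c j) (alpha_qdet n q \<alpha> j)) = \<zero>\<^bsub>qmat_alg n q\<^esub>}"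

text \<open>\<open>singular_alphas n q\<close> is finite for every admissible \<open>q\<close>: it is the zero set of
  the polynomial \<open>det (F_coeff n q \<alpha> i j)\<close> in \<open>\<alpha>\<close>, whose value at \<open>0\<close> is \<open>1\<close>. So the
  convention that infinite sets have cardinality 0 plays no role here.\<close>

definition generic_parameter :: "nat \<Rightarrow> complex \<Rightarrow> bool" where
  "generic_parameter n q \<longleftrightarrow>
     (\<forall>q'. nonzero_non_root_of_unity q' \<longrightarrow>
        card (singular_alphas n q') \<le> card (singular_alphas n q))"

end

theory Submission
  imports Defs
begin

text \<open>For rows \<open>r > s\<close> the relations rewrite \<open>x\<^sub>r\<^sub>k x\<^sub>s\<^sub>l\<close> as the row-ordered pair of letters with the
  columns transformed by a Hecke operator \<open>T\<close> on \<open>V \<otimes> V\<close>, whose matrix in the standard basis is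
  symmetric. Along a reduced word \<open>w = s\<^sub>1 \<cdots> s\<^sub>m\<close> the monomial with rows \<open>w\<close> has
  row-ordered coordinates given by a product of such operators, and reversing the word transposes
  the product. So the coefficient matrices of \<open>w\<close> and of its inverse are transposes of each other,
  while \<open>\<nu>\<close> and \<open>\<ell>\<close> agree on both; summing over \<open>w\<close> gives a symmetric matrix. The coordinates are
  well defined because the row-ordered monomials are independent: by the Yang-Baxter equation,
  left multiplication acts on the span of the words with increasing rows.\<close>

section \<open>A representation on words with increasing rows\<close>

text \<open>Together with \<open>keep_coeff\<close> this gives the entries of the Hecke operator
  \<open>T\<close>, normalized so that (T - 1/q)(T + q) = 0.\<close>

definition swap_coeff :: "complex \<Rightarrow> nat \<Rightarrow> nat \<Rightarrow> complex" where
  "swap_coeff q k l = (if k = l then inverse q else 1)"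

definition keep_coeff :: "complex \<Rightarrow> nat \<Rightarrow> nat \<Rightarrow> complex" where
  "keep_coeff q k l = (if l < k then q - inverse q else 0)"

text \<open>\<open>\<psi>\<close> stands for a linear functional on words. For \<open>r > s\<close> the defining relations say
  \<open>x\<^sub>r\<^sub>k x\<^sub>s\<^sub>l = swap_coeff k l x\<^sub>s\<^sub>l x\<^sub>r\<^sub>k - keep_coeff k l x\<^sub>s\<^sub>k x\<^sub>r\<^sub>l\<close>; \<open>insert_letter\<close> applies this to
  move \<open>x\<^sub>r\<^sub>k\<close> into a word with increasing rows and kills words with a repeated row.\<close>

fun insert_letter ::
    "complex \<Rightarrow> nat \<Rightarrow> nat \<Rightarrow> (nat \<times> nat) list \<Rightarrow> ((nat \<times> nat) list \<Rightarrow> complex) \<Rightarrow> complex" where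
  "insert_letter q r k [] \<psi> = \<psi> [(r, k)]"
| "insert_letter q r k ((s, l) # x) \<psi> =
     (if r < s then \<psi> ((r, k) # (s, l) # x)
      else if r = s then 0
      else swap_coeff q k l * insert_letter q r k x (\<lambda>y. \<psi> ((s, l) # y))
         - keep_coeff q k l * insert_letter q r l x (\<lambda>y. \<psi> ((s, k) # y)))"

lemma insert_letter_lin:
  "insert_letter q r k x (\<lambda>y. a * f y + b * g y) =
     a * insert_letter q r k x f + b * insert_letter q r k x g"
  by (induction q r k x f arbitrary: f g rule: insert_letter.induct) (simp_all add: algebra_simps)

lemma insert_letter_add:
  "insert_letter q r k x (\<lambda>y. f y + g y) = insert_letter q r k x f + insert_letter q r k x g"
  using insert_letter_lin[of q r k x 1 f 1 g] by simp

lemma insert_letter_diff: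
  "insert_letter q r k x (\<lambda>y. f y - g y) = insert_letter q r k x f - insert_letter q r k x g"
  using insert_letter_lin[of q r k x 1 f "-1" g] by simp

lemma insert_letter_scale:
  "insert_letter q r k x (\<lambda>y. a * f y) = a * insert_letter q r k x f"
  using insert_letter_lin[of q r k x a f 0 f] by simp

lemma insert_letter_zero: "insert_letter q r k x (\<lambda>y. 0) = 0"
  using insert_letter_scale[of q r k x 0] by simp

lemmas insert_letter_linear =
  insert_letter_add insert_letter_diff insert_letter_scale insert_letter_zero

text \<open>If the first insertion survives, the second letter passes the same smaller rows and then
  meets the first one, which kills the word. Hence both sides of a relation between letters of one
  row act as 0.\<close>

lemma insert_letter_same_row:
  "insert_letter q r l x (\<lambda>y. insert_letter q r k y \<psi>) = 0"
proof (induction x arbitrary: k l \<psi>)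
  case (Cons a x)
  obtain t m where "a = (t, m)" by (cases a)
  then show ?case
    using Cons.IH by (auto simp: insert_letter_linear)
qed simp

text \<open>In this functional form the outermost insertion acts first, so the identity is the
  rewriting rule for left multiplication by two letters. If the head of the word has a row above
  \<open>s\<close>, the letter of row \<open>s\<close> stays in front and the defining clause
  applies; if the head has row \<open>s\<close>, all terms vanish; only smaller rows need the
  induction.\<close>

lemma insert_letter_exchange:
  assumes "s < r" "q \<noteq> 0"
  shows "insert_letter q s l x (\<lambda>y. insert_letter q r k y \<psi>) =
      swap_coeff q k l * insert_letter q r k x (\<lambda>y. insert_letter q s l y \<psi>)
    - keep_coeff q k l * insert_letter q r l x (\<lambda>y. insert_letter q s k y \<psi>)"
proof (induction x arbitrary: k l \<psi>)
  case Nil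
  then show ?case using assms by simp
next
  case (Cons a x)
  obtain t m where a: "a = (t, m)" by (cases a)
  consider "s < t" | "s = t" | "t < s" by linarith
  then show ?case
  proof cases
    case 1
    then show ?thesis using assms by (auto simp: a insert_letter_linear)
  next
    case 2
    then show ?thesis using assms by (auto simp: a insert_letter_linear)
  next
    case 3
    have IH: "insert_letter q s l x (\<lambda>y. insert_letter q r k y \<psi>) =
      swap_coeff q k l * insert_letter q r k x (\<lambda>y. insert_letter q s l y \<psi>)
    - keep_coeff q k l * insert_letter q r l x (\<lambda>y. insert_letter q s k y \<psi>)" for k l \<psi>
      by (rule Cons.IH)
    \<comment> \<open>Moving both letters past \<open>(t, m)\<close> makes this the Yang-Baxter equation; it is checked
      for each relative order of \<open>k\<close>, \<open>l\<close>, \<open>m\<close>.\<close>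
    from 3 assms show ?thesis
      by (simp add: a insert_letter_linear IH)
        (cases k l rule: linorder_cases; cases k m rule: linorder_cases; cases l m rule: linorder_cases;
          simp add: swap_coeff_def keep_coeff_def; simp add: field_simps)
  qed
qed

text \<open>This is \<psi> evaluated at the product of the word with \<open>x\<close>. The last
  letter acts first, so the first letter is pushed into the functional.\<close>

fun word_act ::
    "complex \<Rightarrow> (nat \<times> nat) list \<Rightarrow> (nat \<times> nat) list \<Rightarrow> ((nat \<times> nat) list \<Rightarrow> complex) \<Rightarrow> complex" where
  "word_act q [] x \<psi> = \<psi> x"
| "word_act q ((r, k) # u) x \<psi> = word_act q u x (\<lambda>y. insert_letter q r k y \<psi>)"

lemma word_act_append: "word_act q (u @ v) x \<psi> = word_act q v x (\<lambda>y. word_act q u y \<psi>)"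
  by (induction q u x \<psi> rule: word_act.induct) simp_all

lemma word_act_lin:
  "word_act q u x (\<lambda>y. a * f y + b * g y) = a * word_act q u x f + b * word_act q u x g"
  by (induction q u x f arbitrary: g rule: word_act.induct) (simp_all add: insert_letter_linear)

lemma word_act_zero: "word_act q u x (\<lambda>y. 0) = 0"
  using word_act_lin[of q u x 0 _ 0] by simp

text \<open>Each letter has a row below that of the current head, so it lands in front without any
  exchange. Row-ordered words are thus recovered from the empty word, which makes them
  independent.\<close>

lemma word_act_sorted:
  "sorted_wrt (<) (map fst u) \<Longrightarrow> word_act q u [] \<psi> = \<psi> u"
proof (induction u arbitrary: \<psi>)
  case (Cons a u)
  obtain r k where a: "a = (r, k)" by (cases a)
  have "insert_letter q r k u \<psi> = \<psi> ((r, k) # u)"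
    using Cons.prems a by (cases u) auto
  then show ?case using Cons a by simp
qed simp

section \<open>Evaluating the representation on noncommutative polynomials\<close>

text \<open>The polynomial acts on the empty word and the result is paired with \<psi>; the sum over
  all words has finite support.\<close>

definition act_form ::
    "complex \<Rightarrow> ((nat \<times> nat) list \<Rightarrow> complex) \<Rightarrow> nc_poly \<Rightarrow> complex" where
  "act_form q \<psi> f = (\<Sum>u. Poly_Mapping.lookup f u * word_act q (letters u) [] \<psi>)"

lemma act_form_add: "act_form q \<psi> (f + g) = act_form q \<psi> f + act_form q \<psi> g"
  unfolding act_form_def lookup_add distrib_right
  by (rule Sum_any.distrib) (auto intro: finite_subset[OF _ finite_lookup])

lemma act_form_single: 
  "act_form q \<psi> (Poly_Mapping.single u a) = a * word_act q (letters u) [] \<psi>"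
proof -
  have "act_form q \<psi> (Poly_Mapping.single u a) = (\<Sum>v. a * word_act q (letters v) [] \<psi> when v = u)"
    unfolding act_form_def by (rule Sum_any.cong) (auto simp: lookup_single when_def)
  then show ?thesis by simp
qed

lemma act_form_zero [simp]: "act_form q \<psi> 0 = 0"
  by (simp add: act_form_def)

lemma act_form_uminus: "act_form q \<psi> (- f) = - act_form q \<psi> f"
  using act_form_add[of q \<psi> f "- f"] by (simp add: eq_neg_iff_add_eq_0 add.commute)

lemma act_form_diff: "act_form q \<psi> (f - g) = act_form q \<psi> f - act_form q \<psi> g"
  using act_form_add[of q \<psi> f "- g"] by (simp add: act_form_uminus)

lemma act_form_sum: "act_form q \<psi> (sum f A) = (\<Sum>a\<in>A. act_form q \<psi> (f a))"
  by (induction A rule: infinite_finite_induct) (simp_all add: act_form_add)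

lemma nc_poly_eq_sum: "(f :: nc_poly) = (\<Sum>u\<in>Poly_Mapping.keys f. Poly_Mapping.single u (Poly_Mapping.lookup f u))"
  by (rule poly_mapping_eqI) (auto simp: lookup_sum lookup_single when_def in_keys_iff)

lemma nc_const_mult: "nc_const (a * b) = nc_const a * nc_const b"
  by (simp add: nc_const_def mult_single)

lemma nc_const_sum: "nc_const (sum f A) = (\<Sum>a\<in>A. nc_const (f a))"
  by (induction A rule: infinite_finite_induct) (simp_all add: nc_const_def single_add)

lemma nc_const_commute: "f * nc_const a = nc_const a * f"
  by (subst (1 2) nc_poly_eq_sum[of f])
    (simp add: sum_distrib_left sum_distrib_right nc_const_def mult_single mult.commute)

lemma act_form_const: "act_form q \<psi> (nc_const a * f) = a * act_form q \<psi> f"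
proof -
  have "act_form q \<psi> (nc_const a * f) =
      (\<Sum>u\<in>Poly_Mapping.keys f. act_form q \<psi> (nc_const a * Poly_Mapping.single u (Poly_Mapping.lookup f u)))"
    by (subst nc_poly_eq_sum[of f]) (simp add: sum_distrib_left act_form_sum)
  also have "\<dots> = a * (\<Sum>u\<in>Poly_Mapping.keys f. act_form q \<psi> (Poly_Mapping.single u (Poly_Mapping.lookup f u)))"
    by (simp add: nc_const_def mult_single act_form_single sum_distrib_left mult.assoc)
  also have "\<dots> = a * act_form q \<psi> f"
    by (subst (3) nc_poly_eq_sum[of f]) (simp add: act_form_sum)
  finally show ?thesis .
qed

text \<open>The expression is bilinear in \<open>g\<close> and \<open>h\<close> and scalars are
  central, so testing on words is enough.\<close>

lemma act_form_sandwich: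
  assumes "\<And>u v. act_form q \<psi> (Poly_Mapping.single u 1 * f * Poly_Mapping.single v 1) = 0"
  shows "act_form q \<psi> (g * f * h) = 0"
proof -
  have single: "Poly_Mapping.single u a = nc_const a * Poly_Mapping.single u 1" for u a
    by (simp add: nc_const_def mult_single)
  have "act_form q \<psi> (Poly_Mapping.single u a * f * Poly_Mapping.single v b) = 0" for u v a b
  proof -
    have "Poly_Mapping.single u a * f * Poly_Mapping.single v b =
        nc_const a * (Poly_Mapping.single u 1 * f * nc_const b * Poly_Mapping.single v 1)"
      by (simp add: single[of u a] single[of v b] mult.assoc)
    also have "\<dots> = nc_const a * (nc_const b * (Poly_Mapping.single u 1 * f * Poly_Mapping.single v 1))"
      by (simp only: nc_const_commute[of "Poly_Mapping.single u 1 * f" b]) (simp add: mult.assoc)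
    finally have "Poly_Mapping.single u a * f * Poly_Mapping.single v b = \<dots>" .
    then show ?thesis using assms by (simp add: act_form_const)
  qed
  then show ?thesis
    by (subst nc_poly_eq_sum[of g], subst nc_poly_eq_sum[of h])
      (simp add: sum_distrib_left sum_distrib_right act_form_sum)
qed

text \<open>The word \<open>v\<close> acts first and \<open>u\<close> last, so it suffices that a
  relation vanishes as an operator. Same-row relations follow from
  \<open>insert_letter_same_row\<close>, all others from
  \<open>insert_letter_exchange\<close>.\<close>

lemma act_form_relation:
  assumes q: "q \<noteq> 0" and f: "f \<in> qmat_relations n q"
  shows "act_form q \<psi> (Poly_Mapping.single u 1 * f * Poly_Mapping.single v 1) = 0"
proof -
  let ?A = "\<lambda>r k s l. word_act q (letters v) [] (\<lambda>y. insert_letter q s l y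
     (\<lambda>y. insert_letter q r k y (\<lambda>y. word_act q (letters u) y \<psi>)))"
  have word: "act_form q \<psi> (Poly_Mapping.single u 1 * (nc_var r k * nc_var s l) * Poly_Mapping.single v 1)
      = ?A r k s l" for r k s l
    by (simp add: nc_var_def mult_single act_form_single plus_nc_word_def word_act_append)
  have cword: "act_form q \<psi> (Poly_Mapping.single u 1 * (nc_const a * (nc_var r k * nc_var s l)) * Poly_Mapping.single v 1)
      = a * ?A r k s l" for a r k s l
    by (simp add: nc_var_def nc_const_def mult_single act_form_single plus_nc_word_def zero_nc_word_def word_act_append)
  have exch: "?A r k s l = swap_coeff q k l * ?A s l r k - keep_coeff q k l * ?A s k r l"
    if "s < r" for r k s l
    using word_act_lin[of q "letters v" "[]" "swap_coeff q k l" _ "- keep_coeff q k l"]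
    by (simp add: insert_letter_exchange[OF that q])
  have same: "?A r k r l = 0" for r k l
    by (simp add: insert_letter_same_row word_act_zero)
  note expand = left_diff_distrib right_diff_distrib act_form_diff word cword
  consider (col) i j k where "i < j" "f = nc_var i k * nc_var j k - nc_const q * (nc_var j k * nc_var i k)"
    | (row) i j k where "f = nc_var k i * nc_var k j - nc_const q * (nc_var k j * nc_var k i)"
    | (anti) i j k l where "i < j" "k < l" "f = nc_var i l * nc_var j k - nc_var j k * nc_var i l"
    | (diag) i j k l where "i < j" "k < l" "f = nc_var i k * nc_var j l - nc_var j l * nc_var i k
          - nc_const (q - inverse q) * (nc_var i l * nc_var j k)"
    using f unfolding qmat_relations_def Un_iff mem_Collect_eq
    by (elim disjE exE conjE) (erule (1) that(1), erule that(2), erule (2) that(3), erule (2) that(4))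
  then show ?thesis
  proof cases
    case col
    \<comment> \<open>For equal columns the exchange has only its swap term, with factor
      1/q.\<close>
    have "?A j k i k = inverse q * ?A i k j k"
      using exch[OF col(1), of k k] by (simp add: swap_coeff_def keep_coeff_def)
    then show ?thesis unfolding col(2) expand using q by simp
  next
    case row
    show ?thesis unfolding row expand same by simp
  next
    case anti
    have "?A j k i l = ?A i l j k"
      using exch[OF anti(1), where k = k and l = l] anti(2) by (simp add: swap_coeff_def keep_coeff_def)
    then show ?thesis unfolding anti(3) expand by simp
  next
    case diag
    \<comment> \<open>The letter with the larger row also has the larger column, so
      \<open>keep_coeff\<close> contributes the term with q - 1/q.\<close>
    have "?A j l i k = ?A i k j l - (q - inverse q) * ?A i l j k"
      using exch[OF diag(1), where k = l and l = k] diag(2) by (simp add: swap_coeff_def keep_coeff_def)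
    then show ?thesis unfolding diag(3) expand by simp
  qed
qed

section \<open>Passage to the quotient\<close>

lemma free_alg_simps:
  "add (free_alg n) = (+)" "mult (free_alg n) = (*)" "ring.zero (free_alg n) = 0" "one (free_alg n) = 1"
  by (simp_all add: free_alg_def)

lemma single_in_free_alg:
  "set u \<subseteq> {1..n} \<times> {1..n} \<Longrightarrow> Poly_Mapping.single (Word u) a \<in> carrier (free_alg n)"
  by (auto simp: free_alg_def split: if_splits)

lemma nc_var_in_free_alg: "i \<in> {1..n} \<Longrightarrow> j \<in> {1..n} \<Longrightarrow> nc_var i j \<in> carrier (free_alg n)"
  by (auto simp: nc_var_def intro!: single_in_free_alg)

lemma nc_const_in_free_alg: "nc_const a \<in> carrier (free_alg n)"
  using single_in_free_alg[of "[]" n a] by (simp add: nc_const_def zero_nc_word_def)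

lemma free_alg_closed:
  assumes "f \<in> carrier (free_alg n)" "g \<in> carrier (free_alg n)"
  shows "f + g \<in> carrier (free_alg n)" "f * g \<in> carrier (free_alg n)"
    "- f \<in> carrier (free_alg n)" "f - g \<in> carrier (free_alg n)"
proof -
  interpret ring "free_alg n" by (rule ring_free_alg)
  show "f + g \<in> carrier (free_alg n)" "f * g \<in> carrier (free_alg n)"
    using add.m_closed[OF assms] m_closed[OF assms] by (simp_all add: free_alg_simps)
  have neg: "- f \<in> carrier (free_alg n)" if "f \<in> carrier (free_alg n)" for f
    using that by (auto simp: free_alg_def in_keys_iff)
  show "- f \<in> carrier (free_alg n)" by (rule neg[OF assms(1)])
  show "f - g \<in> carrier (free_alg n)"
    using add.m_closed[OF assms(1) neg[OF assms(2)]] by (simp add: free_alg_simps)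
qed

lemma free_alg_sum:
  "(\<And>a. a \<in> A \<Longrightarrow> f a \<in> carrier (free_alg n)) \<Longrightarrow> sum f A \<in> carrier (free_alg n)"
  by (induction A rule: infinite_finite_induct)
    (simp_all add: free_alg_closed, simp_all add: free_alg_def)

lemma qmat_relations_subset: "qmat_relations n q \<subseteq> carrier (free_alg n)"
  unfolding qmat_relations_def
  by (auto intro!: free_alg_closed nc_var_in_free_alg nc_const_in_free_alg)

lemma qmat_relation_in_ideal: "f \<in> qmat_relations n q \<Longrightarrow> f \<in> qmat_ideal n q"
  unfolding qmat_ideal_def
  using ring.genideal_self[OF ring_free_alg qmat_relations_subset] by blast

lemma ideal_qmat_ideal: "ideal (qmat_ideal n q) (free_alg n)"
  unfolding qmat_ideal_def by (rule ring.genideal_ideal[OF ring_free_alg qmat_relations_subset])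

lemma qmat_ideal_closed:
  assumes "f \<in> qmat_ideal n q"
  shows "g \<in> qmat_ideal n q \<Longrightarrow> f + g \<in> qmat_ideal n q"
    and "g \<in> carrier (free_alg n) \<Longrightarrow> g * f \<in> qmat_ideal n q"
    and "g \<in> carrier (free_alg n) \<Longrightarrow> f * g \<in> qmat_ideal n q"
    and "- f \<in> qmat_ideal n q"
    and "g \<in> qmat_ideal n q \<Longrightarrow> f - g \<in> qmat_ideal n q"
proof -
  interpret ideal "qmat_ideal n q" "free_alg n" by (rule ideal_qmat_ideal)
  have add: "f + g \<in> qmat_ideal n q" if "f \<in> qmat_ideal n q" "g \<in> qmat_ideal n q" for f g
    using additive_subgroup.a_closed[OF is_additive_subgroup that] by (simp add: free_alg_simps)
  have neg: "- f \<in> qmat_ideal n q" if "f \<in> qmat_ideal n q" for f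
    using I_l_closed[OF that nc_const_in_free_alg[of "-1"]]
    by (simp add: free_alg_simps nc_const_def single_uminus)
  show "g \<in> qmat_ideal n q \<Longrightarrow> f + g \<in> qmat_ideal n q" "- f \<in> qmat_ideal n q"
    using assms add neg by auto
  show "g \<in> carrier (free_alg n) \<Longrightarrow> g * f \<in> qmat_ideal n q"
    "g \<in> carrier (free_alg n) \<Longrightarrow> f * g \<in> qmat_ideal n q"
    using I_l_closed[OF assms] I_r_closed[OF assms] by (auto simp: free_alg_simps)
  show "g \<in> qmat_ideal n q \<Longrightarrow> f - g \<in> qmat_ideal n q"
    using add[OF assms neg] by simp
qed

lemma act_form_qmat_ideal:
  assumes "q \<noteq> 0" "f \<in> qmat_ideal n q"
  shows "act_form q \<psi> f = 0"
proof -
  interpret ring "free_alg n" by (rule ring_free_alg)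
  \<comment> \<open>The kernel of a linear functional need not be an ideal; requiring that all
    two-sided multiples be killed produces one, and it contains the defining relations.\<close>
  define K where "K = {f \<in> carrier (free_alg n). \<forall>g h. act_form q \<psi> (g * f * h) = 0}"
  have "subgroup K (add_monoid (free_alg n))"
  proof (rule add.subgroupI)
    show "K \<noteq> {}"
      by (auto simp: K_def free_alg_def intro!: exI[of _ 0])
    show "\<ominus>\<^bsub>free_alg n\<^esub> f \<in> K" if "f \<in> K" for f
    proof -
      have "\<ominus>\<^bsub>free_alg n\<^esub> f = - f"
        using that by (intro minus_equality) (auto simp: K_def free_alg_simps free_alg_closed)
      then show ?thesis
        using that by (auto simp: K_def free_alg_closed act_form_uminus)
    qed
  qed (auto simp: K_def free_alg_simps free_alg_closed distrib_left distrib_right act_form_add)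
  then have "ideal K (free_alg n)"
    by (intro idealI ring_free_alg)
      (auto simp: K_def free_alg_simps free_alg_closed mult.assoc, simp flip: mult.assoc)
  moreover have "qmat_relations n q \<subseteq> K"
    using qmat_relations_subset act_form_sandwich act_form_relation[OF assms(1)]
    unfolding K_def by blast
  ultimately have "qmat_ideal n q \<subseteq> K"
    unfolding qmat_ideal_def by (rule genideal_minimal)
  then have "act_form q \<psi> (1 * f * 1) = 0"
    using assms(2) unfolding K_def by blast
  then show ?thesis by simp
qed

lemma qmat_class_hom: "ring_hom_ring (free_alg n) (qmat_alg n q) (qmat_class n q)"
  using ideal.rcos_ring_hom_ring[OF ideal_qmat_ideal[of n q]]
  by (simp add: qmat_alg_def qmat_class_def[abs_def])

lemma qmat_class_eq_iff:
  assumes "f \<in> carrier (free_alg n)" "g \<in> carrier (free_alg n)"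
  shows "qmat_class n q f = qmat_class n q g \<longleftrightarrow> f - g \<in> qmat_ideal n q"
proof -
  interpret ring "free_alg n" by (rule ring_free_alg)
  have "\<ominus>\<^bsub>free_alg n\<^esub> g = - g"
    using assms by (intro minus_equality) (auto simp: free_alg_simps free_alg_closed)
  then show ?thesis
    using quotient_eq_iff_same_a_r_cos[OF ideal_qmat_ideal assms, of q]
    by (simp add: qmat_class_def a_minus_def free_alg_simps)
qed

lemma qmat_class_mult:
  assumes "f \<in> carrier (free_alg n)" "g \<in> carrier (free_alg n)"
  shows "qmat_class n q f \<otimes>\<^bsub>qmat_alg n q\<^esub> qmat_class n q g = qmat_class n q (f * g)"
  using ring_hom_mult[OF ring_hom_ring.homh[OF qmat_class_hom] assms] by (simp add: free_alg_simps)

lemma qmat_smult_class: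
  "f \<in> carrier (free_alg n) \<Longrightarrow> qmat_smult n q a (qmat_class n q f) = qmat_class n q (nc_const a * f)"
  by (simp add: qmat_smult_def qmat_class_mult nc_const_in_free_alg)

lemma qmat_class_finsum:
  assumes "finite A" "\<And>a. a \<in> A \<Longrightarrow> f a \<in> carrier (free_alg n)"
  shows "finsum (qmat_alg n q) (\<lambda>a. qmat_class n q (f a)) A = qmat_class n q (sum f A)"
proof -
  interpret ring_hom_ring "free_alg n" "qmat_alg n q" "qmat_class n q" by (rule qmat_class_hom)
  have add: "qmat_class n q f \<oplus>\<^bsub>qmat_alg n q\<^esub> qmat_class n q g = qmat_class n q (f + g)"
    if "f \<in> carrier (free_alg n)" "g \<in> carrier (free_alg n)" for f g
    using hom_add[OF that] by (simp add: free_alg_simps)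
  show ?thesis
    using assms
  proof (induction A rule: finite_induct)
    case empty
    then show ?case using hom_zero by (simp add: free_alg_simps)
  next
    case (insert a A)
    have closed: "qmat_class n q (f b) \<in> carrier (qmat_alg n q)" if "b \<in> insert a A" for b
      by (rule hom_closed[OF insert.prems[OF that]])
    have "(\<Oplus>\<^bsub>qmat_alg n q\<^esub>b\<in>insert a A. qmat_class n q (f b)) =
        qmat_class n q (f a) \<oplus>\<^bsub>qmat_alg n q\<^esub> (\<Oplus>\<^bsub>qmat_alg n q\<^esub>b\<in>A. qmat_class n q (f b))"
      using closed by (intro S.finsum_insert[OF insert.hyps]) blast+
    also have "\<dots> = qmat_class n q (f a + sum f A)"
      using insert.prems insert.IH by (simp only: add free_alg_sum insert_iff simp_thms)
    finally show ?case using insert.hyps by simp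
  qed
qed

section \<open>Monomials with prescribed rows and columns\<close>

definition row_word :: "nat \<Rightarrow> (nat \<Rightarrow> nat) \<Rightarrow> (nat \<Rightarrow> nat) \<Rightarrow> (nat \<times> nat) list" where
  "row_word n w j = map (\<lambda>k. (w k, j k)) [1..<Suc n]"

definition row_monomial :: "nat \<Rightarrow> (nat \<Rightarrow> nat) \<Rightarrow> (nat \<Rightarrow> nat) \<Rightarrow> nc_poly" where
  "row_monomial n w j = Poly_Mapping.single (Word (row_word n w j)) 1"

lemma multi_indices_range: "j \<in> multi_indices n \<Longrightarrow> k \<in> {1..n} \<Longrightarrow> j k \<in> {1..n}"
  by (auto simp: multi_indices_def PiE_def Pi_def)

lemma finite_multi_indices: "finite (multi_indices n)"
  unfolding multi_indices_def by (intro finite_PiE) auto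

lemma set_row_word: "set (row_word n w j) = (\<lambda>k. (w k, j k)) ` {1..n}"
  by (simp add: row_word_def atLeastLessThanSuc_atLeastAtMost del: upt_Suc)

lemma letter_in_square:
  assumes "w permutes {1..n}" "j \<in> multi_indices n" "k \<in> {1..n}"
  shows "(w k, j k) \<in> {1..n} \<times> {1..n}"
  using permutes_in_image[OF assms(1), of k] multi_indices_range[OF assms(2,3)] assms(3)
  by (intro SigmaI) blast+

lemma row_monomial_in_free_alg:
  assumes "w permutes {1..n}" "j \<in> multi_indices n"
  shows "row_monomial n w j \<in> carrier (free_alg n)"
  unfolding row_monomial_def
  by (rule single_in_free_alg)
    (unfold set_row_word, intro image_subsetI letter_in_square[OF assms])

lemma qmat_monomial_eq_class:
  assumes "w permutes {1..n}" "j \<in> multi_indices n"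
  shows "qmat_monomial n q w j = qmat_class n q (row_monomial n w j)"
proof -
  have "foldr (\<lambda>k a. qmat_gen n q (w k) (j k) \<otimes>\<^bsub>qmat_alg n q\<^esub> a) ks \<one>\<^bsub>qmat_alg n q\<^esub>
      = qmat_class n q (Poly_Mapping.single (Word (map (\<lambda>k. (w k, j k)) ks)) 1)"
    if "set ks \<subseteq> {1..n}" for ks
    using that
  proof (induction ks)
    case Nil
    then show ?case
      using ring_hom_one[OF ring_hom_ring.homh[OF qmat_class_hom], of n q]
      by (simp add: free_alg_simps flip: single_one zero_nc_word_def)
  next
    case (Cons k ks)
    have k: "w k \<in> {1..n}" "j k \<in> {1..n}"
      using Cons.prems letter_in_square[OF assms, of k] unfolding list.set(2) insert_subset
      by blast+
    have "Poly_Mapping.single (Word (map (\<lambda>k. (w k, j k)) ks)) 1 \<in> carrier (free_alg n)"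
      using Cons.prems unfolding list.set(2) insert_subset
      by (intro single_in_free_alg)
        (unfold set_map, intro image_subsetI letter_in_square[OF assms], blast)
    then show ?case
      using Cons k
      by (simp add: qmat_gen_def qmat_class_mult nc_var_in_free_alg)
        (simp add: nc_var_def mult_single plus_nc_word_def)
  qed
  from this[of "[1..<Suc n]"] show ?thesis
    unfolding qmat_monomial_def row_monomial_def row_word_def
    by (simp del: upt_Suc add: subset_iff)
qed

section \<open>Cycle counts\<close>

text \<open>With \<open>n\<close> distinct orbits the orbit map is injective on
  \<open>{1..n}\<close>; as \<open>w x\<close> and \<open>x\<close> share an orbit, every point is
  fixed. This is why only the identity survives at \<alpha> = 0.\<close>

lemma cycle_count_less:
  assumes w: "w permutes {1..n}" and "w \<noteq> id"
  shows "cycle_count n w < n"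
proof (rule ccontr)
  assume "\<not> cycle_count n w < n"
  then have "card (orbit w ` {1..n}) = card {1..n}"
    using card_image_le[of "{1..n}" "orbit w"] by (simp add: cycle_count_def)
  then have inj: "inj_on (orbit w) {1..n}"
    by (simp add: eq_card_imp_inj_on)
  have perm: "permutation w"
    using w by (auto simp: permutation_permutes)
  have "w x = x" if "x \<in> {1..n}" for x
  proof -
    have "orbit w (w x) = orbit w x"
      by (simp add: permutation_orbit_step perm)
    then show ?thesis
      using inj_onD[OF inj] that permutes_in_image[OF w, of x] by blast
  qed
  then have "w x = x" for x
    using permutes_not_in[OF w] by blast
  then show False using assms(2) by auto
qed

lemma cycle_count_id: "cycle_count n id = n"
  by (simp add: cycle_count_def orbit_eq_singleton_iff[THEN iffD2] card_image)

lemma cycle_count_inv: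
  assumes "w permutes {1..n}"
  shows "cycle_count n (inv_into UNIV w) = cycle_count n w"
proof -
  have "permutation w" using assms by (auto simp: permutation_permutes)
  then have "orbit (inv_into UNIV w) = orbit w" by (intro ext orbit_inv_eq)
  then show ?thesis by (simp add: cycle_count_def)
qed

section \<open>Reduced words\<close>

abbreviation adj :: "nat \<Rightarrow> nat \<Rightarrow> nat" where
  "adj p \<equiv> Transposition.transpose p (Suc p)"

lemma adj_permutes: "p \<in> {1..<n} \<Longrightarrow> adj p permutes {1..n}"
  by (rule permutes_swap_id) auto

lemma adj_less:
  assumes "a < b" "(a, b) \<noteq> (p, Suc p)"
  shows "adj p a < adj p b"
  using assms by (auto simp: transpose_def split: if_splits)

definition inversions :: "nat \<Rightarrow> (nat \<Rightarrow> nat) \<Rightarrow> (nat \<times> nat) set" where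
  "inversions n w = {(a, b). a \<in> {1..n} \<and> b \<in> {1..n} \<and> a < b \<and> w b < w a}"

lemma perm_length_eq: "perm_length n w = card (inversions n w)"
  by (simp add: perm_length_def inversions_def)

lemma finite_inversions: "finite (inversions n w)"
  by (rule finite_subset[of _ "{1..n} \<times> {1..n}"]) (auto simp: inversions_def)

text \<open>Among increasing pairs, \<open>adj p\<close> reverses only \<open>(p, Suc p)\<close>.
  Applied to both entries it therefore carries the inversions of \<open>w \<circ> adj p\<close>
  bijectively onto those of \<open>w\<close> other than \<open>(p, Suc p)\<close>.\<close>

lemma perm_length_descent:
  assumes p: "p \<in> {1..<n}" and desc: "w (Suc p) < w p"
  shows "perm_length n w = Suc (perm_length n (w \<circ> adj p))"
proof -
  let ?m = "map_prod (adj p) (adj p)"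
  have range: "adj p a \<in> {1..n} \<longleftrightarrow> a \<in> {1..n}" for a
    by (rule permutes_in_image[OF adj_permutes[OF p]])
  have "inversions n w = insert (p, Suc p) (?m ` inversions n (w \<circ> adj p))" (is "?L = ?R")
  proof (intro equalityI subsetI)
    fix x assume x: "x \<in> ?L"
    obtain a b where ab: "x = (a, b)" by (cases x)
    show "x \<in> ?R"
    proof (cases "x = (p, Suc p)")
      case False
      then have "(adj p a, adj p b) \<in> inversions n (w \<circ> adj p)"
        using x range[of a] range[of b] adj_less[of a b p] by (simp add: ab inversions_def)
      then have "?m (adj p a, adj p b) \<in> ?m ` inversions n (w \<circ> adj p)" by (rule imageI)
      then show ?thesis by (simp add: ab)
    qed simp
  next
    fix x assume "x \<in> ?R"
    then consider "x = (p, Suc p)" | a b where "x = (adj p a, adj p b)" "(a, b) \<in> inversions n (w \<circ> adj p)"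
      by auto
    then show "x \<in> ?L"
    proof cases
      case 1
      then show ?thesis using p desc by (simp add: inversions_def)
    next
      case 2
      then have "(a, b) \<noteq> (p, Suc p)" using desc by (auto simp: inversions_def)
      then show ?thesis
        using 2 range[of a] range[of b] adj_less[of a b p] by (simp add: inversions_def)
    qed
  qed
  moreover have "(p, Suc p) \<notin> ?m ` inversions n (w \<circ> adj p)"
  proof
    assume "(p, Suc p) \<in> ?m ` inversions n (w \<circ> adj p)"
    then obtain x where x: "(p, Suc p) = ?m x" "x \<in> inversions n (w \<circ> adj p)" by (rule imageE)
    obtain a b where "x = (a, b)" by (cases x)
    with x have ab: "adj p a = p" "adj p b = Suc p" "a < b"
      by (simp_all add: inversions_def)
    have "a = adj p p" "b = adj p (Suc p)"
      using ab(1,2) by (metis transpose_involutory)+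
    with ab(3) show False by simp
  qed
  moreover have "inj_on ?m (inversions n (w \<circ> adj p))"
    by (rule inj_on_inverseI[where g = ?m]) (simp add: map_prod_def split_beta)
  ultimately show ?thesis
    by (simp add: perm_length_eq finite_inversions card_image)
qed

lemma perm_length_ascent:
  assumes "p \<in> {1..<n}" "w p < w (Suc p)"
  shows "perm_length n (w \<circ> adj p) = Suc (perm_length n w)"
  using perm_length_descent[of p n "w \<circ> adj p"] assms by (simp add: comp_assoc)

text \<open>An inversion \<open>(a, b)\<close> of \<open>w\<close> corresponds to the inversion
  \<open>(w b, w a)\<close> of its inverse.\<close>

lemma perm_length_inv:
  assumes w: "w permutes {1..n}"
  shows "perm_length n (inv_into UNIV w) = perm_length n w"
proof -
  have range: "w a \<in> {1..n} \<longleftrightarrow> a \<in> {1..n}" "inv_into UNIV w a \<in> {1..n} \<longleftrightarrow> a \<in> {1..n}" for a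
    using permutes_in_image[OF w] permutes_in_image[OF permutes_inv[OF w]] by blast+
  have "bij_betw (\<lambda>(a, b). (w b, w a)) (inversions n w) (inversions n (inv_into UNIV w))"
  proof (rule bij_betw_byWitness[where f' = "\<lambda>(a, b). (inv_into UNIV w b, inv_into UNIV w a)"])
    show "(\<lambda>(a, b). (w b, w a)) ` inversions n w \<subseteq> inversions n (inv_into UNIV w)"
      using range permutes_inverses[OF w] by (auto simp only: inversions_def mem_Collect_eq prod.case)
    show "(\<lambda>(a, b). (inv_into UNIV w b, inv_into UNIV w a)) ` inversions n (inv_into UNIV w) \<subseteq> inversions n w"
      using range permutes_inverses[OF w] by (auto simp only: inversions_def mem_Collect_eq prod.case)
  qed (simp_all add: permutes_inverses[OF w] split_beta)
  then show ?thesis by (simp add: perm_length_eq bij_betw_same_card)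
qed

lemma perm_length_id: "perm_length n id = 0"
  by (auto simp: perm_length_def card_eq_0_iff)

text \<open>An increasing \<open>w\<close> satisfies \<open>k \<le> w k\<close> throughout
  \<open>{1..n}\<close>, which forces a permutation of this set to be the identity.\<close>

lemma permutes_no_descent:
  assumes w: "w permutes {1..n}" and asc: "\<And>p. p \<in> {1..<n} \<Longrightarrow> w p < w (Suc p)"
  shows "w = id"
proof -
  have "k \<in> {1..n} \<Longrightarrow> k \<le> w k" for k
  proof (induction k)
    case (Suc k)
    then show ?case
      using asc[of k] permutes_in_image[OF w, of "Suc k"] by (cases "k = 0") auto
  qed simp
  then show ?thesis by (intro permutes_natset_ge[OF w]) blast
qed

section \<open>Words in adjacent transpositions\<close>

definition adj_prod :: "nat list \<Rightarrow> nat \<Rightarrow> nat" where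
  "adj_prod ps = foldr (\<lambda>p w. adj p \<circ> w) ps id"

lemma adj_prod_simps [simp]:
  "adj_prod [] = id" "adj_prod (p # ps) = adj p \<circ> adj_prod ps"
  by (simp_all add: adj_prod_def)

lemma adj_prod_snoc: "adj_prod (ps @ [p]) = adj_prod ps \<circ> adj p"
  by (induction ps) (simp_all add: comp_assoc)

lemma adj_prod_permutes: "set ps \<subseteq> {1..<n} \<Longrightarrow> adj_prod ps permutes {1..n}"
proof (induction ps)
  case (Cons p ps)
  then have "p \<in> {1..<n}" "adj_prod ps permutes {1..n}" by simp_all
  from this(2) adj_permutes[OF this(1)] show ?case
    unfolding adj_prod_simps by (rule permutes_compose)
qed (simp add: permutes_id)

lemma adj_prod_rev: "set ps \<subseteq> {1..<n} \<Longrightarrow> adj_prod (rev ps) = inv_into UNIV (adj_prod ps)"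
proof (induction ps)
  case (Cons p ps)
  then have "p \<in> {1..<n}" and ps: "set ps \<subseteq> {1..<n}" by simp_all
  have "inv_into UNIV (adj p \<circ> adj_prod ps) = inv_into UNIV (adj_prod ps) \<circ> inv_into UNIV (adj p)"
    by (rule o_inv_distrib[OF bij_transpose permutes_bij[OF adj_prod_permutes[OF ps]]])
  then show ?case
    by (simp only: rev.simps adj_prod_snoc adj_prod_simps Cons.IH[OF ps] inv_transpose_eq)
qed simp

text \<open>Appending one adjacent transposition changes the length by exactly one, up or
  down.\<close>

lemma perm_length_adj_prod: "set ps \<subseteq> {1..<n} \<Longrightarrow> perm_length n (adj_prod ps) \<le> length ps"
proof (induction ps rule: rev_induct)
  case Nil
  show ?case unfolding adj_prod_simps perm_length_id by simp
next
  case (snoc p ps)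
  have "inj (adj_prod ps)"
    using snoc.prems permutes_inj[OF adj_prod_permutes, of ps n] by simp
  then consider "adj_prod ps (Suc p) < adj_prod ps p" | "adj_prod ps p < adj_prod ps (Suc p)"
    by (metis inj_eq n_not_Suc_n neq_iff)
  moreover have p: "p \<in> {1..<n}" and IH: "perm_length n (adj_prod ps) \<le> length ps"
    using snoc by simp_all
  ultimately show ?case
    unfolding adj_prod_snoc length_append_singleton
    using IH by cases (use perm_length_descent[OF p, of "adj_prod ps"]
        perm_length_ascent[OF p, of "adj_prod ps"] in linarith)+
qed

text \<open>A permutation other than the identity has a descent \<open>p\<close>; composing with
  \<open>adj p\<close> shortens it by one, and \<open>p\<close> becomes the last letter of the
  word.\<close>

lemma reduced_word_exists:
  assumes "w permutes {1..n}"
  shows "\<exists>ps. set ps \<subseteq> {1..<n} \<and> adj_prod ps = w \<and> perm_length n w = length ps"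
  using assms
proof (induction "perm_length n w" arbitrary: w rule: less_induct)
  case less
  show ?case
  proof (cases "w = id")
    case True
    then show ?thesis by (intro exI[of _ "[]"]) (simp add: perm_length_id)
  next
    case False
    then obtain p where p: "p \<in> {1..<n}" "\<not> w p < w (Suc p)"
      using permutes_no_descent[OF less.prems] by blast
    then have desc: "w (Suc p) < w p"
      using permutes_inj[OF less.prems] by (simp add: inj_eq not_less le_less)
    have "w \<circ> adj p permutes {1..n}"
      by (rule permutes_compose[OF adj_permutes[OF p(1)] less.prems])
    then obtain ps where ps: "set ps \<subseteq> {1..<n}" "adj_prod ps = w \<circ> adj p"
        "perm_length n (w \<circ> adj p) = length ps"
      using less.hyps perm_length_descent[OF p(1), of w, OF desc] by force
    then show ?thesis
      using p(1) perm_length_descent[OF p(1), of w, OF desc]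
      by (intro exI[of _ "ps @ [p]"]) (simp add: adj_prod_snoc comp_assoc)
  qed
qed

text \<open>If the last letter shortened the product, the total length would fall below
  \<open>length ps\<close> by \<open>perm_length_adj_prod\<close>. So it lengthens the product, and
  the prefix is reduced as well.\<close>

lemma reduced_snoc:
  assumes "set (ps @ [p]) \<subseteq> {1..<n}" "perm_length n (adj_prod (ps @ [p])) = length (ps @ [p])"
  shows "perm_length n (adj_prod ps) = length ps" "adj_prod ps p < adj_prod ps (Suc p)"
proof -
  have p: "p \<in> {1..<n}" and ps: "set ps \<subseteq> {1..<n}" using assms(1) by auto
  have "adj_prod ps p \<noteq> adj_prod ps (Suc p)"
    using permutes_inj[OF adj_prod_permutes[OF ps]] by (simp add: inj_eq)
  moreover have "\<not> adj_prod ps (Suc p) < adj_prod ps p"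
    using perm_length_descent[OF p, of "adj_prod ps"] perm_length_adj_prod[OF ps] assms(2)
    by (auto simp: adj_prod_snoc)
  ultimately show asc: "adj_prod ps p < adj_prod ps (Suc p)" by simp
  show "perm_length n (adj_prod ps) = length ps"
    using perm_length_ascent[OF p, of "adj_prod ps", OF asc] assms(2) by (simp add: adj_prod_snoc)
qed

section \<open>Normal ordering by Hecke operators\<close>

text \<open>The Hecke operator \<open>T\<close> in the tensor positions \<open>p\<close> and
  \<open>Suc p\<close>, acting on functions of the column indices.\<close>

definition adj_op ::
    "complex \<Rightarrow> nat \<Rightarrow> ((nat \<Rightarrow> nat) \<Rightarrow> complex) \<Rightarrow> (nat \<Rightarrow> nat) \<Rightarrow> complex" where
  "adj_op q p g j =
     swap_coeff q (j p) (j (Suc p)) * g (j \<circ> adj p) - keep_coeff q (j p) (j (Suc p)) * g j"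

lemma adj_multi_indices:
  assumes p: "p \<in> {1..<n}" and j: "j \<in> multi_indices n"
  shows "j \<circ> adj p \<in> multi_indices n"
  unfolding multi_indices_def
proof (rule PiE_I)
  fix k assume "k \<in> {1..n}"
  then have "adj p k \<in> {1..n}"
    using permutes_in_image[OF adj_permutes[OF p]] by blast
  then show "(j \<circ> adj p) k \<in> {1..n}"
    using multi_indices_range[OF j, of "adj p k"] by (simp only: comp_apply)
next
  fix k assume k: "k \<notin> {1..n}"
  then have "adj p k = k"
    by (rule permutes_not_in[OF adj_permutes[OF p]])
  then show "(j \<circ> adj p) k = undefined"
    using j k by (simp add: multi_indices_def PiE_def extensional_def)
qed

lemma adj_op_cong:
  assumes "p \<in> {1..<n}" "j \<in> multi_indices n" "\<And>k. k \<in> multi_indices n \<Longrightarrow> f k = g k"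
  shows "adj_op q p f j = adj_op q p g j"
  using assms(2,3) adj_multi_indices[OF assms(1,2)] by (simp add: adj_op_def)

text \<open>The keep part is diagonal. The swap part exchanges \<open>j\<close> and
  \<open>j \<circ> adj p\<close>, and its coefficient depends only on whether the two columns agree,
  which the exchange does not change.\<close>

lemma adj_op_symmetric:
  assumes p: "p \<in> {1..<n}"
  shows "(\<Sum>j\<in>multi_indices n. adj_op q p f j * g j) = (\<Sum>j\<in>multi_indices n. f j * adj_op q p g j)"
proof -
  have "(\<Sum>j\<in>multi_indices n. swap_coeff q (j p) (j (Suc p)) * f (j \<circ> adj p) * g j) =
      (\<Sum>j\<in>multi_indices n. swap_coeff q (j p) (j (Suc p)) * f j * g (j \<circ> adj p))"
    by (rule sum.reindex_bij_witness[where i = "\<lambda>j. j \<circ> adj p" and j = "\<lambda>j. j \<circ> adj p"])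
      (simp_all add: adj_multi_indices[OF p] comp_assoc swap_coeff_def)
  then show ?thesis
    by (simp add: adj_op_def algebra_simps sum_subtractf)
qed

text \<open>Transposing a product of symmetric operators reverses their order; \<open>fold\<close>
  applies the head of the list first.\<close>

lemma fold_adj_op_symmetric:
  assumes "set ps \<subseteq> {1..<n}"
  shows "(\<Sum>j\<in>multi_indices n. fold (adj_op q) ps f j * g j) =
     (\<Sum>j\<in>multi_indices n. f j * fold (adj_op q) (rev ps) g j)"
  using assms
proof (induction ps arbitrary: f)
  case (Cons p ps)
  then show ?case
    using adj_op_symmetric[of p n q f] by (simp del: fold_rev)
qed simp

section \<open>Exchanging neighbouring rows modulo the ideal\<close>

text \<open>Isolating the two positions allows the exchange relation to be multiplied by the common
  outer words \<open>A\<close> and \<open>B\<close>.\<close>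

lemma row_word_split:
  assumes p: "p \<in> {1..<n}"
  obtains A B where
    "row_word n w j = A @ [(w p, j p), (w (Suc p), j (Suc p))] @ B"
    "row_word n (w \<circ> adj p) j = A @ [(w (Suc p), j p), (w p, j (Suc p))] @ B"
    "row_word n (w \<circ> adj p) (j \<circ> adj p) = A @ [(w (Suc p), j (Suc p)), (w p, j p)] @ B"
    "set A \<subseteq> set (row_word n w j)" "set B \<subseteq> set (row_word n w j)"
proof -
  let ?f = "\<lambda>k. (w k, j k)"
  have split: "[1..<Suc n] = [1..<p] @ [p, Suc p] @ [Suc (Suc p)..<Suc n]"
  proof -
    have "[1..<Suc n] = [1..<p] @ [p..<Suc n]"
      using p upt_add_eq_append[of 1 p "Suc n - p"] by simp
    also have "[p..<Suc n] = [p, Suc p] @ [Suc (Suc p)..<Suc n]"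
      using p by (simp add: upt_conv_Cons del: upt_Suc)
    finally show ?thesis .
  qed
  have other: "adj p k = k" if "k \<in> set [1..<p] \<union> set [Suc (Suc p)..<Suc n]" for k
    using that by (auto simp: transpose_def)
  show thesis
  proof (rule that[of "map ?f [1..<p]" "map ?f [Suc (Suc p)..<Suc n]"])
    show "row_word n w j = map ?f [1..<p] @ [?f p, ?f (Suc p)] @ map ?f [Suc (Suc p)..<Suc n]"
      unfolding row_word_def split by (simp del: upt_Suc)
    then show "set (map ?f [1..<p]) \<subseteq> set (row_word n w j)"
      "set (map ?f [Suc (Suc p)..<Suc n]) \<subseteq> set (row_word n w j)"
      by (auto simp del: upt_Suc)
    show "row_word n (w \<circ> adj p) j =
        map ?f [1..<p] @ [(w (Suc p), j p), (w p, j (Suc p))] @ map ?f [Suc (Suc p)..<Suc n]"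
      using other unfolding row_word_def split by (simp del: upt_Suc)
    show "row_word n (w \<circ> adj p) (j \<circ> adj p) =
        map ?f [1..<p] @ [?f (Suc p), ?f p] @ map ?f [Suc (Suc p)..<Suc n]"
      using other unfolding row_word_def split by (simp del: upt_Suc)
  qed
qed

text \<open>For \<open>k = l\<close> this is the column relation times -1/q, for
  \<open>k < l\<close> the negated commutation relation, and for \<open>l < k\<close> the negated
  relation containing q - 1/q.\<close>

lemma exchange_in_qmat_ideal:
  assumes q: "q \<noteq> 0" and rs: "s < r" and ind: "r \<in> {1..n}" "s \<in> {1..n}" "k \<in> {1..n}" "l \<in> {1..n}"
  shows "nc_var r k * nc_var s l - (nc_const (swap_coeff q k l) * (nc_var s l * nc_var r k)
      - nc_const (keep_coeff q k l) * (nc_var s k * nc_var r l)) \<in> qmat_ideal n q" (is "?rel \<in> _")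
proof -
  consider "k = l" | "k < l" | "l < k" by linarith
  then show ?thesis
  proof cases
    case 1
    have "nc_var s k * nc_var r k - nc_const q * (nc_var r k * nc_var s k) \<in> qmat_ideal n q"
      (is "?f \<in> _")
      by (rule qmat_relation_in_ideal, unfold qmat_relations_def) (use rs ind in blast)
    then have "nc_const (- inverse q) * ?f \<in> qmat_ideal n q"
      by (rule qmat_ideal_closed(2)) (rule nc_const_in_free_alg)
    moreover have "nc_const (- inverse q) * ?f = ?rel"
    proof -
      have "nc_const (- inverse q) * nc_const q = - 1"
        using q by (simp add: nc_const_def mult_single single_uminus)
      moreover have "nc_const (- inverse q) = - nc_const (inverse q)"
        by (simp add: nc_const_def single_uminus)
      ultimately show ?thesis
        using 1 by (simp add: swap_coeff_def keep_coeff_def right_diff_distrib nc_const_def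
            flip: mult.assoc)
    qed
    ultimately show ?thesis by simp
  next
    case 2
    have "nc_var s l * nc_var r k - nc_var r k * nc_var s l \<in> qmat_ideal n q"
      by (rule qmat_relation_in_ideal, unfold qmat_relations_def) (use rs ind 2 in blast)
    from qmat_ideal_closed(4)[OF this] show ?thesis
      using 2 by (simp add: swap_coeff_def keep_coeff_def nc_const_def)
  next
    case 3
    have "nc_var s l * nc_var r k - nc_var r k * nc_var s l
        - nc_const (q - inverse q) * (nc_var s k * nc_var r l) \<in> qmat_ideal n q"
      by (rule qmat_relation_in_ideal, unfold qmat_relations_def) (use rs ind 3 in blast)
    from qmat_ideal_closed(4)[OF this] show ?thesis
      using 3 by (simp add: swap_coeff_def keep_coeff_def nc_const_def algebra_simps)
  qed
qed

lemma row_monomial_descent: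
  assumes q: "q \<noteq> 0" and w: "w permutes {1..n}" and p: "p \<in> {1..<n}" and desc: "w (Suc p) < w p"
    and j: "j \<in> multi_indices n"
  shows "row_monomial n w j -
      (nc_const (swap_coeff q (j p) (j (Suc p))) * row_monomial n (w \<circ> adj p) (j \<circ> adj p)
       - nc_const (keep_coeff q (j p) (j (Suc p))) * row_monomial n (w \<circ> adj p) j) \<in> qmat_ideal n q"
proof -
  obtain A B where AB:
    "row_word n w j = A @ [(w p, j p), (w (Suc p), j (Suc p))] @ B"
    "row_word n (w \<circ> adj p) j = A @ [(w (Suc p), j p), (w p, j (Suc p))] @ B"
    "row_word n (w \<circ> adj p) (j \<circ> adj p) = A @ [(w (Suc p), j (Suc p)), (w p, j p)] @ B"
    and sub: "set A \<subseteq> set (row_word n w j)" "set B \<subseteq> set (row_word n w j)"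
    by (rule row_word_split[OF p])
  let ?a = "Poly_Mapping.single (Word A) (1 :: complex)"
  let ?b = "Poly_Mapping.single (Word B) (1 :: complex)"
  have "set (row_word n w j) \<subseteq> {1..n} \<times> {1..n}"
    unfolding set_row_word by (intro image_subsetI letter_in_square[OF w j])
  then have ab: "?a \<in> carrier (free_alg n)" "?b \<in> carrier (free_alg n)"
    using sub by (blast intro: single_in_free_alg)+
  have mono: "?a * (nc_var r k * nc_var s l) * ?b =
      Poly_Mapping.single (Word (A @ [(r, k), (s, l)] @ B)) 1" for r k s l
    by (simp add: nc_var_def mult_single plus_nc_word_def)
  have cmono: "?a * (nc_const c * f) * ?b = nc_const c * (?a * f * ?b)" for c f
    by (simp only: nc_const_commute[of ?a c] flip: mult.assoc)
  have ind: "w p \<in> {1..n}" "w (Suc p) \<in> {1..n}" "j p \<in> {1..n}" "j (Suc p) \<in> {1..n}"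
    using letter_in_square[OF w j, of p] letter_in_square[OF w j, of "Suc p"] p by simp_all
  have "?a * (nc_var (w p) (j p) * nc_var (w (Suc p)) (j (Suc p))
      - (nc_const (swap_coeff q (j p) (j (Suc p))) * (nc_var (w (Suc p)) (j (Suc p)) * nc_var (w p) (j p))
      - nc_const (keep_coeff q (j p) (j (Suc p))) * (nc_var (w (Suc p)) (j p) * nc_var (w p) (j (Suc p))))) * ?b
      \<in> qmat_ideal n q"
    by (intro qmat_ideal_closed(2,3) ab exchange_in_qmat_ideal q desc ind)
  then show ?thesis
    unfolding row_monomial_def AB by (simp only: right_diff_distrib left_diff_distrib mono cmono)
qed

section \<open>Coordinates in the row-ordered monomials\<close>

definition row_coeff :: "nat \<Rightarrow> complex \<Rightarrow> (nat \<Rightarrow> nat) \<Rightarrow> nc_poly \<Rightarrow> complex" where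
  "row_coeff n q i = act_form q (\<lambda>u. if u = row_word n id i then 1 else 0)"

text \<open>The functionals \<open>row_coeff\<close> are dual to the row-ordered monomials. For
  nonzero \<open>q\<close> they also vanish on the ideal, so the monomials stay independent in the
  quotient.\<close>

lemma row_coeff_monomial_id:
  assumes "i \<in> multi_indices n" "k \<in> multi_indices n"
  shows "row_coeff n q i (row_monomial n id k) = (if k = i then 1 else 0)"
proof -
  have "map fst (row_word n id k) = [1..<Suc n]"
    by (simp add: row_word_def o_def del: upt_Suc)
  then have "sorted_wrt (<) (map fst (row_word n id k))"
    by (simp del: upt_Suc)
  moreover have "row_word n id k = row_word n id i \<longleftrightarrow> k = i"
  proof
    assume eq: "row_word n id k = row_word n id i"
    show "k = i"
    proof
      fix x
      show "k x = i x"
      proof (cases "x \<in> {1..n}")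
        case True
        with eq show ?thesis
          by (simp add: row_word_def map_eq_conv atLeastLessThanSuc_atLeastAtMost del: upt_Suc)
      next
        case False
        then show ?thesis
          using assms by (simp add: multi_indices_def PiE_def extensional_def)
      qed
    qed
  qed simp
  ultimately show ?thesis
    by (simp add: row_coeff_def row_monomial_def act_form_single word_act_sorted)
qed

lemma row_coeff_descent:
  assumes q: "q \<noteq> 0" and w: "w permutes {1..n}" and p: "p \<in> {1..<n}" and desc: "w (Suc p) < w p"
    and j: "j \<in> multi_indices n"
  shows "row_coeff n q i (row_monomial n w j) =
    adj_op q p (\<lambda>k. row_coeff n q i (row_monomial n (w \<circ> adj p) k)) j"
  using act_form_qmat_ideal[OF q row_monomial_descent[OF assms]]
  by (simp add: row_coeff_def adj_op_def act_form_diff act_form_const)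

lemma reduced_snoc_descent:
  assumes "set (ps @ [p]) \<subseteq> {1..<n}" "perm_length n (adj_prod (ps @ [p])) = length (ps @ [p])"
  shows "adj_prod (ps @ [p]) (Suc p) < adj_prod (ps @ [p]) p"
    "adj_prod (ps @ [p]) \<circ> adj p = adj_prod ps"
  using reduced_snoc[OF assms] by (simp_all add: adj_prod_snoc comp_assoc)

text \<open>The last letter of a reduced word is a descent of the product. Stripping it applies its
  operator outermost, just as \<open>fold\<close> does, until the empty word leaves the delta
  function at \<open>i\<close>.\<close>

lemma row_coeff_reduced:
  assumes q: "q \<noteq> 0" and i: "i \<in> multi_indices n"
    and "set ps \<subseteq> {1..<n}" "perm_length n (adj_prod ps) = length ps" "j \<in> multi_indices n"
  shows "row_coeff n q i (row_monomial n (adj_prod ps) j) =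
    fold (adj_op q) ps (\<lambda>k. if k = i then 1 else 0) j"
  using assms(3-)
proof (induction ps arbitrary: j rule: rev_induct)
  case Nil
  then show ?case
    using row_coeff_monomial_id[OF i] unfolding adj_prod_simps fold.simps id_apply by blast
next
  case (snoc p ps)
  have p: "p \<in> {1..<n}" and ps: "set ps \<subseteq> {1..<n}" using snoc.prems(1) by auto
  have IH: "row_coeff n q i (row_monomial n (adj_prod ps) k) =
      fold (adj_op q) ps (\<lambda>k. if k = i then 1 else 0) k" if "k \<in> multi_indices n" for k
    using snoc.IH ps that reduced_snoc(1)[OF snoc.prems(1,2)] by blast
  show ?case
    using row_coeff_descent[OF q adj_prod_permutes[OF snoc.prems(1)] p
        reduced_snoc_descent(1)[OF snoc.prems(1,2)] snoc.prems(3), of i]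
    unfolding reduced_snoc_descent(2)[OF snoc.prems(1,2)]
    unfolding fold_append fold.simps comp_apply id_apply
    \<comment> \<open>The induction hypothesis covers multi-indices only, and \<open>adj_op\<close>
      evaluates its argument only at those.\<close>
    using adj_op_cong[OF p snoc.prems(3) IH] by (rule trans)
qed

lemma sum_mult_delta:
  fixes f :: "'a \<Rightarrow> 'b::semiring_1"
  assumes "finite A" "a \<in> A"
  shows "(\<Sum>k\<in>A. f k * (if k = a then 1 else 0)) = f a"
proof -
  have "(\<Sum>k\<in>A. f k * (if k = a then 1 else 0)) = (\<Sum>k\<in>A. if k = a then f k else 0)"
    by (rule sum.cong) simp_all
  then show ?thesis using assms by simp
qed

text \<open>A reversed reduced word of \<open>w\<close> is a word for the inverse, again reduced
  because both lengths agree, and reversal transposes the operator product.\<close>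

lemma row_coeff_inv:
  assumes q: "q \<noteq> 0" and w: "w permutes {1..n}"
    and i: "i \<in> multi_indices n" and j: "j \<in> multi_indices n"
  shows "row_coeff n q j (row_monomial n (inv_into UNIV w) i) = row_coeff n q i (row_monomial n w j)"
proof -
  obtain ps where ps: "set ps \<subseteq> {1..<n}" "adj_prod ps = w" "perm_length n w = length ps"
    using reduced_word_exists[OF w] by blast
  let ?d = "\<lambda>i k. if k = i then 1 else (0 :: complex)"
  have "row_coeff n q i (row_monomial n w j) = fold (adj_op q) ps (?d i) j"
    using row_coeff_reduced[OF q i ps(1) _ j] ps(2,3) by simp
  \<comment> \<open>A matrix entry is written as a pairing with a delta function so that the
    operators can be moved to the other side.\<close>
  also have "\<dots> = (\<Sum>k\<in>multi_indices n. fold (adj_op q) ps (?d i) k * ?d j k)"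
    by (rule sum_mult_delta[OF finite_multi_indices j, symmetric])
  also have "\<dots> = (\<Sum>k\<in>multi_indices n. ?d i k * fold (adj_op q) (rev ps) (?d j) k)"
    by (rule fold_adj_op_symmetric[OF ps(1)])
  also have "\<dots> = fold (adj_op q) (rev ps) (?d j) i"
    by (subst mult.commute) (rule sum_mult_delta[OF finite_multi_indices i])
  also have "\<dots> = row_coeff n q j (row_monomial n (inv_into UNIV w) i)"
    using row_coeff_reduced[OF q j, of "rev ps" i] ps i adj_prod_rev[OF ps(1)] perm_length_inv[OF w]
    by (simp del: fold_rev)
  finally show ?thesis by simp
qed

text \<open>Row-ordered monomials span: one exchange at a descent leads to a shorter permutation,
  and the coordinates obey the same recursion as the monomials.\<close>

lemma row_monomial_expansion:
  assumes q: "q \<noteq> 0" and w: "w permutes {1..n}" and j: "j \<in> multi_indices n"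
  shows "row_monomial n w j -
    (\<Sum>k\<in>multi_indices n. nc_const (row_coeff n q k (row_monomial n w j)) * row_monomial n id k)
    \<in> qmat_ideal n q"
  using w j
proof (induction "perm_length n w" arbitrary: w j rule: less_induct)
  case less
  let ?E = "\<lambda>w j. \<Sum>k\<in>multi_indices n. nc_const (row_coeff n q k (row_monomial n w j)) * row_monomial n id k"
  show ?case
  proof (cases "w = id")
    case True
    have "?E id j = (\<Sum>k\<in>multi_indices n. if k = j then row_monomial n id k else 0)"
      by (rule sum.cong)
        (auto simp: row_coeff_monomial_id less.prems nc_const_def)
    also have "\<dots> = row_monomial n id j"
      using less.prems by (simp add: finite_multi_indices)
    finally show ?thesis
      using additive_subgroup.zero_closed[OF ideal.axioms(1)[OF ideal_qmat_ideal]]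
      by (simp add: True free_alg_simps)
  next
    case False
    then obtain p where p: "p \<in> {1..<n}" "\<not> w p < w (Suc p)"
      using permutes_no_descent[OF less.prems(1)] by blast
    then have desc: "w (Suc p) < w p"
      using permutes_inj[OF less.prems(1)] by (simp add: inj_eq not_less le_less)
    let ?v = "w \<circ> adj p" and ?l = "j \<circ> adj p"
    let ?c = "swap_coeff q (j p) (j (Suc p))" and ?d = "keep_coeff q (j p) (j (Suc p))"
    have v: "?v permutes {1..n}"
      by (rule permutes_compose[OF adj_permutes[OF p(1)] less.prems(1)])
    have l: "?l \<in> multi_indices n" by (rule adj_multi_indices[OF p(1) less.prems(2)])
    have len: "perm_length n ?v < perm_length n w"
      using perm_length_descent[OF p(1), of w, OF desc] by simp
    have coeff: "nc_const (row_coeff n q k (row_monomial n w j)) =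
        nc_const ?c * nc_const (row_coeff n q k (row_monomial n ?v ?l))
        - nc_const ?d * nc_const (row_coeff n q k (row_monomial n ?v j))" for k
      using row_coeff_descent[OF q less.prems(1) p(1) desc less.prems(2), of k]
      by (simp add: adj_op_def nc_const_def mult_single single_diff)
    have E: "?E w j = nc_const ?c * ?E ?v ?l - nc_const ?d * ?E ?v j"
      by (simp only: coeff left_diff_distrib sum_subtractf sum_distrib_left mult.assoc)
    \<comment> \<open>The total error is the error of one exchange plus a combination of the two
      inductive errors.\<close>
    have "row_monomial n w j - (nc_const ?c * row_monomial n ?v ?l - nc_const ?d * row_monomial n ?v j)
        + (nc_const ?c * (row_monomial n ?v ?l - ?E ?v ?l)
           - nc_const ?d * (row_monomial n ?v j - ?E ?v j)) \<in> qmat_ideal n q"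
      by (intro qmat_ideal_closed(1,2,5) nc_const_in_free_alg
          row_monomial_descent q less.prems p(1) desc less.hyps len v l)
    then show ?thesis
      unfolding E by (simp add: algebra_simps)
  qed
qed

section \<open>The \<alpha>-determinants and their coefficients\<close>

lemma alpha_qdet_eq_class:
  assumes j: "j \<in> multi_indices n"
  shows "alpha_qdet n q \<alpha> j = qmat_class n q (\<Sum>w | w permutes {1..n}.
    nc_const (\<alpha> ^ (n - cycle_count n w) * q ^ perm_length n w) * row_monomial n w j)"
proof -
  interpret ring_hom_ring "free_alg n" "qmat_alg n q" "qmat_class n q" by (rule qmat_class_hom)
  let ?f = "\<lambda>w. nc_const (\<alpha> ^ (n - cycle_count n w) * q ^ perm_length n w) * row_monomial n w j"
  have f: "?f w \<in> carrier (free_alg n)" if "w \<in> {w. w permutes {1..n}}" for w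
    using that by (intro free_alg_closed(2) nc_const_in_free_alg row_monomial_in_free_alg[OF _ j]) blast
  have "alpha_qdet n q \<alpha> j = (\<Oplus>\<^bsub>qmat_alg n q\<^esub> w \<in> {w. w permutes {1..n}}. qmat_class n q (?f w))"
    unfolding alpha_qdet_def
  proof (rule S.finsum_cong'[OF refl])
    show "(\<lambda>w. qmat_class n q (?f w)) \<in> {w. w permutes {1..n}} \<rightarrow> carrier (qmat_alg n q)"
      by (intro Pi_I hom_closed f)
  next
    fix w assume "w \<in> {w. w permutes {1..n}}"
    then have w: "w permutes {1..n}" by blast
    show "qmat_smult n q (\<alpha> ^ (n - cycle_count n w) * q ^ perm_length n w) (qmat_monomial n q w j)
        = qmat_class n q (?f w)"
      unfolding qmat_monomial_eq_class[OF w j]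
      by (rule qmat_smult_class[OF row_monomial_in_free_alg[OF w j]])
  qed
  also have "\<dots> = qmat_class n q (\<Sum>w | w permutes {1..n}. ?f w)"
    by (rule qmat_class_finsum[OF _ f]) (rule finite_permutations, simp)
  finally show ?thesis .
qed

lemma alpha_qdet_0:
  assumes j: "j \<in> multi_indices n"
  shows "alpha_qdet n q 0 j = qmat_class n q (row_monomial n id j)"
proof -
  have "(\<Sum>w | w permutes {1..n}.
      nc_const (0 ^ (n - cycle_count n w) * q ^ perm_length n w) * row_monomial n w j)
    = (\<Sum>w | w permutes {1..n}. if w = id then row_monomial n id j else 0)"
  proof (rule sum.cong[OF refl])
    fix w assume "w \<in> {w. w permutes {1..n}}"
    then have w: "w permutes {1..n}" by blast
    show "nc_const (0 ^ (n - cycle_count n w) * q ^ perm_length n w) * row_monomial n w j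
        = (if w = id then row_monomial n id j else 0)"
    proof (cases "w = id")
      case True
      \<comment> \<open>The exponent is \<open>n - n\<close>, and \<open>0 ^ 0 = 1\<close> gives
        coefficient 1.\<close>
      show ?thesis
        unfolding True cycle_count_id perm_length_id by (simp add: nc_const_def)
    next
      case False
      then have "(0 :: complex) ^ (n - cycle_count n w) = 0"
        using cycle_count_less[OF w] by (intro zero_power) simp
      then show ?thesis using False by (simp only: if_False mult_zero_left) (simp add: nc_const_def)
    qed
  qed
  also have "\<dots> = row_monomial n id j"
    using finite_permutations[of "{1..n}"] permutes_id[of "{1..n}"] by (simp only: sum.delta mem_Collect_eq if_True finite_atLeastAtMost)
  finally show ?thesis
    unfolding alpha_qdet_eq_class[OF j] by (rule arg_cong)
qed

text \<open>The definite description has exactly one solution: existence comes from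
  \<open>row_monomial_expansion\<close>, uniqueness from applying the dual functionals
  \<open>row_coeff\<close>.\<close>

lemma F_coeff_eq:
  assumes q: "q \<noteq> 0" and i: "i \<in> multi_indices n" and j: "j \<in> multi_indices n"
  shows "F_coeff n q \<alpha> i j = (\<Sum>w | w permutes {1..n}.
    \<alpha> ^ (n - cycle_count n w) * q ^ perm_length n w * row_coeff n q i (row_monomial n w j))"
proof -
  interpret ring_hom_ring "free_alg n" "qmat_alg n q" "qmat_class n q" by (rule qmat_class_hom)
  let ?P = "{w. w permutes {1..n}}"
  define a where "a w = \<alpha> ^ (n - cycle_count n w) * q ^ perm_length n w" for w
  define f where "f = (\<Sum>w\<in>?P. nc_const (a w) * row_monomial n w j)"
  \<comment> \<open>The description ranges over extensional functions, so the candidate must be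
    \<open>undefined\<close> outside \<open>multi_indices n\<close>.\<close>
  define b where "b = (\<lambda>k\<in>multi_indices n. \<Sum>w\<in>?P. a w * row_coeff n q k (row_monomial n w j))"
  let ?g = "\<lambda>c. \<Sum>k\<in>multi_indices n. nc_const (c k) * row_monomial n id k"
  have id: "id permutes {1..n}" by (rule permutes_id)
  have f: "f \<in> carrier (free_alg n)"
    unfolding f_def
    by (intro free_alg_sum free_alg_closed(2) nc_const_in_free_alg row_monomial_in_free_alg[OF _ j]) blast
  have summand: "nc_const (c k) * row_monomial n id k \<in> carrier (free_alg n)"
    if "k \<in> multi_indices n" for c :: "_ \<Rightarrow> complex" and k
    by (intro free_alg_closed(2) nc_const_in_free_alg row_monomial_in_free_alg[OF id that])
  have g: "?g c \<in> carrier (free_alg n)" for c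
    by (intro free_alg_sum summand)
  have expand: "(\<Oplus>\<^bsub>qmat_alg n q\<^esub> k \<in> multi_indices n. qmat_smult n q (c k) (alpha_qdet n q 0 k))
      = qmat_class n q (?g c)" for c
  proof -
    have "(\<Oplus>\<^bsub>qmat_alg n q\<^esub> k \<in> multi_indices n. qmat_smult n q (c k) (alpha_qdet n q 0 k)) =
        (\<Oplus>\<^bsub>qmat_alg n q\<^esub> k \<in> multi_indices n. qmat_class n q (nc_const (c k) * row_monomial n id k))"
    proof (rule S.finsum_cong'[OF refl])
      show "(\<lambda>k. qmat_class n q (nc_const (c k) * row_monomial n id k))
          \<in> multi_indices n \<rightarrow> carrier (qmat_alg n q)"
        by (intro Pi_I hom_closed summand)
    next
      fix k assume k: "k \<in> multi_indices n"
      show "qmat_smult n q (c k) (alpha_qdet n q 0 k) = qmat_class n q (nc_const (c k) * row_monomial n id k)"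
        unfolding alpha_qdet_0[OF k]
        by (rule qmat_smult_class[OF row_monomial_in_free_alg[OF id k]])
    qed
    also have "\<dots> = qmat_class n q (?g c)"
      by (rule qmat_class_finsum[OF finite_multi_indices summand])
    finally show ?thesis .
  qed
  have det: "alpha_qdet n q \<alpha> j = qmat_class n q f"
    unfolding alpha_qdet_eq_class[OF j] f_def a_def ..
  have iff: "alpha_qdet n q \<alpha> j =
      (\<Oplus>\<^bsub>qmat_alg n q\<^esub> k \<in> multi_indices n. qmat_smult n q (c k) (alpha_qdet n q 0 k))
      \<longleftrightarrow> f - ?g c \<in> qmat_ideal n q" for c
    unfolding det expand by (rule qmat_class_eq_iff[OF f g])
  have coeff_f: "row_coeff n q k f = (\<Sum>w\<in>?P. a w * row_coeff n q k (row_monomial n w j))" for k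
    by (simp add: f_def row_coeff_def act_form_sum act_form_const)
  have unique: "c k = (\<Sum>w\<in>?P. a w * row_coeff n q k (row_monomial n w j))"
    if "f - ?g c \<in> qmat_ideal n q" and k: "k \<in> multi_indices n" for c k
  proof -
    \<comment> \<open>The functional vanishes on the ideal, so it agrees on \<open>f\<close> and
      \<open>?g c\<close>; duality then reads off \<open>c k\<close>.\<close>
    have "row_coeff n q k f = row_coeff n q k (?g c)"
      using act_form_qmat_ideal[OF q that(1)] by (simp add: row_coeff_def act_form_diff)
    also have "\<dots> = (\<Sum>l\<in>multi_indices n. c l * row_coeff n q k (row_monomial n id l))"
      by (simp only: row_coeff_def act_form_sum act_form_const)
    also have "\<dots> = (\<Sum>l\<in>multi_indices n. c l * (if l = k then 1 else 0))"
      by (rule sum.cong[OF refl]) (simp only: row_coeff_monomial_id[OF k])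
    also have "\<dots> = c k"
      by (rule sum_mult_delta[OF finite_multi_indices k])
    finally show ?thesis by (simp only: coeff_f)
  qed
  have sum_ideal: "(\<Sum>w\<in>A. h w) \<in> qmat_ideal n q" if "\<And>w. w \<in> A \<Longrightarrow> h w \<in> qmat_ideal n q" for A h
    using that additive_subgroup.zero_closed[OF ideal.axioms(1)[OF ideal_qmat_ideal[of n q]]]
    by (induction A rule: infinite_finite_induct) (simp_all add: free_alg_simps qmat_ideal_closed(1))
  \<comment> \<open>Exchanging the two sums turns the difference into a weighted sum of expansion
    errors, each of which lies in the ideal.\<close>
  have "f - ?g b = (\<Sum>w\<in>?P. nc_const (a w) * (row_monomial n w j -
      (\<Sum>k\<in>multi_indices n. nc_const (row_coeff n q k (row_monomial n w j)) * row_monomial n id k)))"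
  proof -
    have "nc_const (b k) = (\<Sum>w\<in>?P. nc_const (a w) * nc_const (row_coeff n q k (row_monomial n w j)))"
      if "k \<in> multi_indices n" for k
      using that by (simp add: b_def nc_const_sum nc_const_mult)
    then have "?g b = (\<Sum>k\<in>multi_indices n. \<Sum>w\<in>?P.
        nc_const (a w) * (nc_const (row_coeff n q k (row_monomial n w j)) * row_monomial n id k))"
      by (intro sum.cong refl) (simp only: sum_distrib_right mult.assoc)
    also have "\<dots> = (\<Sum>w\<in>?P. nc_const (a w) *
        (\<Sum>k\<in>multi_indices n. nc_const (row_coeff n q k (row_monomial n w j)) * row_monomial n id k))"
      by (subst sum.swap) (simp only: sum_distrib_left)
    finally show ?thesis
      by (simp only: f_def right_diff_distrib sum_subtractf)
  qed
  also have "\<dots> \<in> qmat_ideal n q"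
    by (rule sum_ideal, rule qmat_ideal_closed(2)[OF row_monomial_expansion[OF q _ j] nc_const_in_free_alg])
      blast
  finally have b: "f - ?g b \<in> qmat_ideal n q" .
  have "(THE c. c \<in> multi_indices n \<rightarrow>\<^sub>E UNIV \<and> f - ?g c \<in> qmat_ideal n q) = b"
  proof (rule the_equality)
    show "b \<in> multi_indices n \<rightarrow>\<^sub>E UNIV \<and> f - ?g b \<in> qmat_ideal n q"
      using b by (simp add: b_def)
    show "c = b" if c: "c \<in> multi_indices n \<rightarrow>\<^sub>E UNIV \<and> f - ?g c \<in> qmat_ideal n q" for c
    proof (rule extensionalityI)
      show "c \<in> extensional (multi_indices n)" using c by (simp add: PiE_def)
      show "b \<in> extensional (multi_indices n)" by (simp add: b_def)
      show "c k = b k" if "k \<in> multi_indices n" for k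
        using unique[OF conjunct2[OF c] that] that by (simp add: b_def)
    qed
  qed
  then have "F_coeff n q \<alpha> i j = b i"
    unfolding F_coeff_def iff by (rule fun_cong)
  then show ?thesis using i by (simp add: b_def a_def)
qed

text \<open>Reindexing by inversion preserves the weights, since cycle count and length are
  unchanged, while \<open>row_coeff_inv\<close> exchanges \<open>i\<close> and
  \<open>j\<close>.\<close>

lemma F_coeff_symmetric:
  assumes q: "q \<noteq> 0" and i: "i \<in> multi_indices n" and j: "j \<in> multi_indices n"
  shows "F_coeff n q \<alpha> i j = F_coeff n q \<alpha> j i"
  unfolding F_coeff_eq[OF q i j] F_coeff_eq[OF q j i]
proof (rule sum.reindex_bij_witness[where i = "inv_into UNIV" and j = "inv_into UNIV"])
  fix w assume "w \<in> {w. w permutes {1..n}}"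
  then have w: "w permutes {1..n}" by blast
  then show "inv_into UNIV (inv_into UNIV w) = w" "inv_into UNIV (inv_into UNIV w) = w"
      "inv_into UNIV w \<in> {w. w permutes {1..n}}" "inv_into UNIV w \<in> {w. w permutes {1..n}}"
    by (simp_all only: permutes_inv_inv permutes_inv mem_Collect_eq)
  show "\<alpha> ^ (n - cycle_count n (inv_into UNIV w)) * q ^ perm_length n (inv_into UNIV w)
        * row_coeff n q j (row_monomial n (inv_into UNIV w) i)
      = \<alpha> ^ (n - cycle_count n w) * q ^ perm_length n w * row_coeff n q i (row_monomial n w j)"
    by (simp only: cycle_count_inv[OF w] perm_length_inv[OF w] row_coeff_inv[OF q w i j])
qed

theorem proposition3p8:
  fixes n :: nat and q \<alpha> :: complex and lam :: "nat \<Rightarrow> nat"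
  assumes "n \<ge> 1"
    and "nonzero_non_root_of_unity q"
    and "generic_parameter n q"
    and "(\<Sum>p\<in>{1..n}. lam p) = n"
  shows "\<forall>i \<in> weight_indices n lam. \<forall>j \<in> weight_indices n lam.
           F_coeff n q \<alpha> i j = F_coeff n q \<alpha> j i"
proof -
  have "q \<noteq> 0" using assms(2) by (simp add: nonzero_non_root_of_unity_def)
  \<comment> \<open>Indices of weight \<open>lam\<close> are multi-indices, so the matrix is a
    principal block of the full symmetric one.\<close>
  then show ?thesis
    unfolding weight_indices_def using F_coeff_symmetric by blast
qed

end
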